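(* Let $\mu>0$, let $a,b$ be real numbers with $b-a$ an integer $\ge 2$, and put $I=\{a+1,a+2,\dots,b-1\}$. Let $p,q,r:I\to\mathbb{R}$ with $p(t)>0$ and $r(t)>0$ for all $t\in I$. Consider the discrete fractional Sturm-Liouville equation $$\nabla_a^{\mu}\big(p(t)\,{}_b\nabla^{\mu}x(t)\big)+q(t)x(t)=\lambda r(t)x(t),\qquad t\in I .$$ Eigenfunctions of this equation corresponding to distinct eigenvalues are orthogonal with respect to the weight $r$: if $u,v$ are eigenfunctions with eigenvalues $\lambda_\alpha\ne\lambda_\beta$ respectively, then $\sum_{s=a+1}^{b-1}r(s)u(s)\overline{v(s)}=0$.
   Context: An eigenvalue is a $\lambda\in\mathbb{C}$ for which the equation has a solution $x:I\to\mathbb{C}$ that is not identically zero; such an $x$ is an eigenfunction corresponding to $\lambda$. Notation: $\nabla x(t)=x(t)-x(t-1)$, $\Delta x(t)=x(t+1)-x(t)$, $\rho(t)=t-1$, and the rising function is $t^{\overline{\alpha}}=\Gamma(t+\alpha)/\Gamma(t)$. Let $n=\lfloor\mu\rfloor+1$. The (Riemann-Liouville) nabla left fractional difference of order $\mu$ is $$\nabla_a^{\mu}x(t)=\frac{1}{\Gamma(n-\mu)}\nabla^{n}\sum_{s=a+1}^{t}(t-\rho(s))^{\overline{n-\mu-1}}x(s),$$ where $\nabla^n$ acts in the variable $t$ and the sum is taken to be $0$ when $t\le a$. The (Riemann-Liouville) nabla right fractional difference of order $\mu$ is $${}_b\nabla^{\mu}x(t)=\frac{(-1)^n}{\Gamma(n-\mu)}\Delta^{n}\sum_{s=t}^{b-1}(s-\rho(t))^{\overline{n-\mu-1}}x(s),$$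 where $\Delta^n$ acts in the variable $t$ and the sum is taken to be $0$ when $t\ge b$. For $t\in I$ both expressions depend only on the values of $x$ on $I$. The expression $\nabla_a^{\mu}(p(t)\,{}_b\nabla^{\mu}x(t))$ means $\nabla_a^\mu$ applied to the function $t\mapsto p(t)\cdot({}_b\nabla^\mu x)(t)$ on $I$. *)

theory Defs
  imports "HOL-Analysis.Analysis"
begin

definition rising :: "real \<Rightarrow> real \<Rightarrow> real" where
  "rising t \<alpha> = Gamma (t + \<alpha>) / Gamma t"

definition nabla :: "(real \<Rightarrow> complex) \<Rightarrow> real \<Rightarrow> complex" where
  "nabla x t = x t - x (t - 1)"

definition Delta :: "(real \<Rightarrow> complex) \<Rightarrow> real \<Rightarrow> complex" where
  "Delta x t = x (t + 1) - x t"

definition rho :: "real \<Rightarrow> real" where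
  "rho t = t - 1"

text \<open>
  The unit-step grid \<open>{c, c + 1, \<dots>, d}\<close> for real \<open>c\<close>, \<open>d\<close> with \<open>d - c\<close> an integer; it is empty
  if \<open>d < c\<close>, so that the empty sums in the fractional differences are \<open>0\<close> as they should be.
\<close>

definition grid :: "real \<Rightarrow> real \<Rightarrow> real set" where
  "grid c d = {s. c \<le> s \<and> s \<le> d \<and> s - c \<in> \<int>}"

definition diff_order :: "real \<Rightarrow> nat" where
  "diff_order \<mu> = nat (\<lfloor>\<mu>\<rfloor> + 1)"

text \<open>
  Functions on \<open>grid (a + 1) (b - 1)\<close> are represented by total functions on the reals. At points of
  that grid, both fractional differences below only evaluate \<open>x\<close> at points of that grid.
\<close>

definition nabla_left :: "real \<Rightarrow> real \<Rightarrow> (real \<Rightarrow> complex) \<Rightarrow> real \<Rightarrow> complex" where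
  "nabla_left a \<mu> x t =
     (let n = diff_order \<mu> in
      of_real (1 / Gamma (real n - \<mu>)) *
      (nabla ^^ n)
        (\<lambda>t. \<Sum>s\<in>grid (a + 1) t. of_real (rising (t - rho s) (real n - \<mu> - 1)) * x s) t)"

definition nabla_right :: "real \<Rightarrow> real \<Rightarrow> (real \<Rightarrow> complex) \<Rightarrow> real \<Rightarrow> complex" where
  "nabla_right b \<mu> x t =
     (let n = diff_order \<mu> in
      of_real ((-1) ^ n / Gamma (real n - \<mu>)) *
      (Delta ^^ n)
        (\<lambda>t. \<Sum>s\<in>grid t (b - 1). of_real (rising (s - rho t) (real n - \<mu> - 1)) * x s) t)"

definition eigenfunction ::
  "real \<Rightarrow> real \<Rightarrow> real \<Rightarrow> (real \<Rightarrow> real) \<Rightarrow> (real \<Rightarrow> real) \<Rightarrow> (real \<Rightarrow> real) \<Rightarrow>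
    complex \<Rightarrow> (real \<Rightarrow> complex) \<Rightarrow> bool" where
  "eigenfunction a b \<mu> p q r lam x \<longleftrightarrow>
     (\<exists>t\<in>grid (a + 1) (b - 1). x t \<noteq> 0) \<and>
     (\<forall>t\<in>grid (a + 1) (b - 1).
        nabla_left a \<mu> (\<lambda>s. of_real (p s) * nabla_right b \<mu> x s) t + of_real (q t) * x t
          = lam * of_real (r t) * x t)"

end

theory Submission
  imports Defs
begin

text \<open>
  On the grid both fractional differences are convolutions with one real kernel \<open>w\<close>:
  the left difference at \<open>t\<close> is the sum of \<open>w (t - s) * x s\<close>, the right one the sum of
  \<open>w (s - t) * x s\<close>. So they are transposes of each other, the operator
  composed of the right difference, multiplication by the real function \<open>p\<close> and the left
  difference is Hermitian, and the usual argument gives real eigenvalues and orthogonality.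
\<close>

lemma finite_grid: "finite (grid c d)"
proof (rule finite_subset)
  show "grid c d \<subseteq> (\<lambda>i. c + of_int i) ` {0..\<lfloor>d - c\<rfloor>}"
  proof
    fix s assume s: "s \<in> grid c d"
    then obtain i where i: "s - c = of_int i"
      by (auto simp: grid_def elim: Ints_cases)
    then have "s = c + of_int i" "0 \<le> i" "i \<le> \<lfloor>d - c\<rfloor>"
      using s by (auto simp: grid_def le_floor_iff)
    then show "s \<in> (\<lambda>i. c + of_int i) ` {0..\<lfloor>d - c\<rfloor>}"
      by auto
  qed
qed simp

lemma grid_restrict_le:
  assumes "t \<le> d"
  shows "grid c t = {s \<in> grid c d. s \<le> t}"
  using assms by (auto simp: grid_def)

text \<open>A grid is anchored at its left end, so \<open>grid t d\<close> lies on the lattice of c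
  only when t - c is an integer. Cutting at the right end, as in \<open>grid_restrict_le\<close>,
  leaves the anchor alone.\<close>

lemma grid_restrict_ge:
  assumes "c \<le> t" "t - c \<in> \<int>"
  shows "grid t d = {s \<in> grid c d. t \<le> s}"
proof -
  have "s - t \<in> \<int> \<longleftrightarrow> s - c \<in> \<int>" for s
    using Ints_add[OF _ assms(2), of "s - t"] Ints_diff[OF _ assms(2), of "s - c"] by auto
  then show ?thesis
    using assms by (auto simp: grid_def)
qed

lemma nabla_funpow_convolution:
  "(nabla ^^ n) (\<lambda>t. \<Sum>s\<in>S. k (t - s) * x s) = (\<lambda>t. \<Sum>s\<in>S. (nabla ^^ n) k (t - s) * x s)"
  by (induction n) (simp_all add: nabla_def fun_eq_iff sum_subtractf algebra_simps)

text \<open>A forward step in t is a backward step in the argument s - t, with reversed sign: k (s -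
  t - 1) - k (s - t) = - \<open>nabla\<close> k (s - t). Each of the n differences contributes one
  factor -1.\<close>

lemma Delta_funpow_convolution:
  "(Delta ^^ n) (\<lambda>t. \<Sum>s\<in>S. k (s - t) * x s)
     = (\<lambda>t. (-1) ^ n * (\<Sum>s\<in>S. (nabla ^^ n) k (s - t) * x s))"
  by (induction n)
    (simp_all add: nabla_def Delta_def fun_eq_iff right_diff_distrib left_diff_distrib
      sum_subtractf diff_diff_eq)

lemma nabla_funpow_cong:
  assumes "\<And>t. t \<le> d \<Longrightarrow> f t = g t" and "t \<le> d"
  shows "(nabla ^^ n) f t = (nabla ^^ n) g t"
  using \<open>t \<le> d\<close> by (induction n arbitrary: t) (simp_all add: assms(1) nabla_def)

text \<open>Forward differences at t look only at t, t + 1, and so on. Agreement is asked for on the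
  lattice of c alone, since \<open>grid_restrict_ge\<close> supplies it only there.\<close>

lemma Delta_funpow_cong:
  assumes "\<And>t. c \<le> t \<Longrightarrow> t - c \<in> \<int> \<Longrightarrow> f t = g t" and "c \<le> t" "t - c \<in> \<int>"
  shows "(Delta ^^ n) f t = (Delta ^^ n) g t"
  using assms(2,3)
proof (induction n arbitrary: t)
  case 0
  then show ?case by (simp add: assms(1))
next
  case (Suc n)
  have "t + 1 - c \<in> \<int>"
    using Ints_add[OF Suc.prems(2) Ints_1] by (simp add: algebra_simps)
  then show ?case
    using Suc by (simp add: Delta_def)
qed

lemma nabla_funpow_Reals:
  assumes "\<And>t. k t \<in> \<real>"
  shows "(nabla ^^ n) k t \<in> \<real>"
  using assms by (induction n arbitrary: t) (auto simp: nabla_def)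

text \<open>Extension by 0 to negative arguments lets a sum with a limit depending on t run over the
  whole grid, so that differences in t pass under the sum without boundary terms. The shift d + 1 is
  t - \<open>rho\<close> s for d = t - s.\<close>

definition rising_kernel :: "real \<Rightarrow> real \<Rightarrow> complex" where
  "rising_kernel \<nu> d = (if 0 \<le> d then of_real (rising (d + 1) \<nu>) else 0)"

definition diff_kernel :: "real \<Rightarrow> real \<Rightarrow> complex" where
  "diff_kernel \<mu> d =
     of_real (1 / Gamma (real (diff_order \<mu>) - \<mu>)) *
     (nabla ^^ diff_order \<mu>) (rising_kernel (real (diff_order \<mu>) - \<mu> - 1)) d"

lemma cnj_diff_kernel [simp]: "cnj (diff_kernel \<mu> d) = diff_kernel \<mu> d"
proof -
  have "(nabla ^^ n) (rising_kernel \<nu>) d \<in> \<real>" for n \<nu>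
    by (rule nabla_funpow_Reals) (simp add: rising_kernel_def)
  then show ?thesis
    by (simp add: diff_kernel_def Reals_cnj_iff)
qed

lemma nabla_left_eq_convolution:
  assumes "t \<le> b - 1"
  shows "nabla_left a \<mu> x t = (\<Sum>s\<in>grid (a + 1) (b - 1). diff_kernel \<mu> (t - s) * x s)"
proof -
  define n where "n = diff_order \<mu>"
  define \<nu> where "\<nu> = real n - \<mu> - 1"
  have "(\<Sum>s\<in>grid (a + 1) \<tau>. of_real (rising (\<tau> - rho s) \<nu>) * x s)
      = (\<Sum>s\<in>grid (a + 1) (b - 1). rising_kernel \<nu> (\<tau> - s) * x s)" if "\<tau> \<le> b - 1" for \<tau>
    \<comment> \<open>The added terms have s > \<tau> and hence kernel value 0. This also covers
      \<tau> < a + 1, which backward differences may reach: both sums are then 0.\<close>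
    unfolding grid_restrict_le[OF that]
    by (intro sum.mono_neutral_cong_left)
      (auto simp: finite_grid rising_kernel_def rho_def algebra_simps)
  then have "(nabla ^^ n) (\<lambda>\<tau>. \<Sum>s\<in>grid (a + 1) \<tau>. of_real (rising (\<tau> - rho s) \<nu>) * x s) t
      = (nabla ^^ n) (\<lambda>\<tau>. \<Sum>s\<in>grid (a + 1) (b - 1). rising_kernel \<nu> (\<tau> - s) * x s) t"
    using assms by (rule nabla_funpow_cong)
  then show ?thesis
    by (simp add: nabla_left_def diff_kernel_def Let_def nabla_funpow_convolution
        sum_divide_distrib flip: n_def \<nu>_def)
qed

lemma nabla_right_eq_convolution:
  assumes "a + 1 \<le> t" "t - (a + 1) \<in> \<int>"
  shows "nabla_right b \<mu> x t = (\<Sum>s\<in>grid (a + 1) (b - 1). diff_kernel \<mu> (s - t) * x s)"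
proof -
  define n where "n = diff_order \<mu>"
  define \<nu> where "\<nu> = real n - \<mu> - 1"
  have "(\<Sum>s\<in>grid \<tau> (b - 1). of_real (rising (s - rho \<tau>) \<nu>) * x s)
      = (\<Sum>s\<in>grid (a + 1) (b - 1). rising_kernel \<nu> (s - \<tau>) * x s)"
    if "a + 1 \<le> \<tau>" "\<tau> - (a + 1) \<in> \<int>" for \<tau>
    unfolding grid_restrict_ge[OF that]
    by (intro sum.mono_neutral_cong_left)
      (auto simp: finite_grid rising_kernel_def rho_def algebra_simps)
  then have "(Delta ^^ n) (\<lambda>\<tau>. \<Sum>s\<in>grid \<tau> (b - 1). of_real (rising (s - rho \<tau>) \<nu>) * x s) t
      = (Delta ^^ n) (\<lambda>\<tau>. \<Sum>s\<in>grid (a + 1) (b - 1). rising_kernel \<nu> (s - \<tau>) * x s) t"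
    using assms by (rule Delta_funpow_cong)
  \<comment> \<open>The sign in \<open>nabla_right\<close> cancels the one from
    \<open>Delta_funpow_convolution\<close>, which leaves the same kernel as for the left
    difference.\<close>
  moreover have "(-1) ^ n * ((-1) ^ n * z) = z" for z :: complex
    by (simp flip: mult.assoc power_mult_distrib)
  ultimately show ?thesis
    by (simp add: nabla_right_def diff_kernel_def Let_def Delta_funpow_convolution
        sum_divide_distrib flip: n_def \<nu>_def)
qed

text \<open>Summation by parts: in the double sum over the kernel the order of summation is
  exchanged, and the kernel, being real, moves inside the conjugate.\<close>

lemma sum_nabla_left_eq_sum_nabla_right:
  "(\<Sum>t\<in>grid (a + 1) (b - 1). nabla_left a \<mu> f t * cnj (y t))
     = (\<Sum>t\<in>grid (a + 1) (b - 1). f t * cnj (nabla_right b \<mu> y t))"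
proof -
  let ?G = "grid (a + 1) (b - 1)"
  have "(\<Sum>t\<in>?G. nabla_left a \<mu> f t * cnj (y t))
      = (\<Sum>t\<in>?G. \<Sum>s\<in>?G. diff_kernel \<mu> (t - s) * f s * cnj (y t))"
    by (intro sum.cong refl)
      (auto simp: grid_def nabla_left_eq_convolution[where b = b] sum_distrib_right)
  also have "\<dots> = (\<Sum>s\<in>?G. \<Sum>t\<in>?G. diff_kernel \<mu> (t - s) * f s * cnj (y t))"
    by (rule sum.swap)
  also have "\<dots> = (\<Sum>s\<in>?G. f s * cnj (nabla_right b \<mu> y s))"
    by (intro sum.cong refl)
      (auto simp: grid_def nabla_right_eq_convolution[where a = a] sum_distrib_left mult_ac)
  finally show ?thesis .
qed

text \<open>The equation is multiplied by \<open>cnj (y s)\<close> and summed by parts. The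
  resulting right-hand side is a Hermitian form in x and y, because p and q are real.\<close>

lemma eigenfunction_sum:
  assumes "eigenfunction a b \<mu> p q r lam x"
  shows "lam * (\<Sum>s\<in>grid (a + 1) (b - 1). of_real (r s) * x s * cnj (y s))
     = (\<Sum>s\<in>grid (a + 1) (b - 1).
          of_real (p s) * nabla_right b \<mu> x s * cnj (nabla_right b \<mu> y s)
          + of_real (q s) * x s * cnj (y s))"
proof -
  let ?G = "grid (a + 1) (b - 1)"
  let ?f = "\<lambda>s. of_real (p s) * nabla_right b \<mu> x s"
  have "lam * (\<Sum>s\<in>?G. of_real (r s) * x s * cnj (y s))
      = (\<Sum>s\<in>?G. (nabla_left a \<mu> ?f s + of_real (q s) * x s) * cnj (y s))"
    using assms by (auto simp: eigenfunction_def sum_distrib_left mult.assoc intro!: sum.cong)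
  then show ?thesis
    by (simp add: distrib_right sum.distrib sum_nabla_left_eq_sum_nabla_right)
qed

text \<open>Both sides equal the Hermitian form at (u, v): the left by the equation for u, the right
  by conjugating the equation for v tested against u.\<close>

lemma eigenvalue_conjugate_symmetric:
  assumes "eigenfunction a b \<mu> p q r \<alpha> u" and "eigenfunction a b \<mu> p q r \<beta> v"
  shows "\<alpha> * (\<Sum>s\<in>grid (a + 1) (b - 1). of_real (r s) * u s * cnj (v s))
     = cnj \<beta> * (\<Sum>s\<in>grid (a + 1) (b - 1). of_real (r s) * u s * cnj (v s))"
  using eigenfunction_sum[OF assms(1), of v] arg_cong[OF eigenfunction_sum[OF assms(2), of u], of cnj]
  by (simp add: mult_ac)

lemma eigenvalue_real:
  assumes "eigenfunction a b \<mu> p q r lam x"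
    and r: "\<And>t. t \<in> grid (a + 1) (b - 1) \<Longrightarrow> r t > 0"
  shows "cnj lam = lam"
proof -
  let ?G = "grid (a + 1) (b - 1)"
  obtain t where t: "t \<in> ?G" "x t \<noteq> 0"
    using assms(1) by (auto simp: eigenfunction_def)
  \<comment> \<open>The weighted square norm of x is positive, so it can be cancelled from the
    symmetry identity with u = v = x.\<close>
  have "0 < (\<Sum>s\<in>?G. r s * (cmod (x s))\<^sup>2)"
    using t r by (intro sum_pos2[where i = t]) (auto simp: finite_grid less_imp_le)
  moreover have "(\<Sum>s\<in>?G. of_real (r s) * x s * cnj (x s))
      = complex_of_real (\<Sum>s\<in>?G. r s * (cmod (x s))\<^sup>2)"
    by (simp add: mult.assoc complex_norm_square del: of_real_power)
  ultimately have "(\<Sum>s\<in>?G. of_real (r s) * x s * cnj (x s)) \<noteq> 0"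
    by (metis of_real_eq_0_iff less_irrefl)
  then show ?thesis
    using eigenvalue_conjugate_symmetric[OF assms(1) assms(1)] by simp
qed

theorem theorem10:
  fixes \<mu> a b :: real
    and p q r :: "real \<Rightarrow> real"
    and u v :: "real \<Rightarrow> complex"
    and lam_\<alpha> lam_\<beta> :: complex
  assumes "\<mu> > 0"
    and "b - a \<in> \<int>"
    and "b - a \<ge> 2"
    and "\<And>t. t \<in> grid (a + 1) (b - 1) \<Longrightarrow> p t > 0"
    and "\<And>t. t \<in> grid (a + 1) (b - 1) \<Longrightarrow> r t > 0"
    and "eigenfunction a b \<mu> p q r lam_\<alpha> u"
    and "eigenfunction a b \<mu> p q r lam_\<beta> v"
    and "lam_\<alpha> \<noteq> lam_\<beta>"
  shows "(\<Sum>s\<in>grid (a + 1) (b - 1). of_real (r s) * u s * cnj (v s)) = 0"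
  using eigenvalue_conjugate_symmetric[OF assms(6,7)] eigenvalue_real[OF assms(7,5)] assms(8)
  by simp

end
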